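(* Let $G$ be a graph satisfying $\omega(G) \geq \frac{3}{4}(\Delta(G) + 1)$. Then $G$ has an independent set $I$ such that $\omega(G - I) < \omega(G)$.
   Context: Graphs are finite, simple and undirected. $\omega(G)$ denotes the clique number of $G$ (the number of vertices in a largest clique; it is $0$ for the graph with no vertices), $\Delta(G)$ denotes the maximum degree of $G$, and $G - I$ denotes the subgraph of $G$ induced on $V(G) \setminus I$. *)

theory Defs
  imports Complex_Main "Graph_Theory.Graph_Theory"
begin

text \<open>
  A finite simple undirected graph is an instance of the locale \<^locale>\<open>graph\<close>: finite vertex and
  arc sets, no loops, no parallel arcs, and a symmetric adjacency relation. Each undirected edge
  is represented by two opposite arcs.
\<close>

definition clique :: "('a, 'b) pre_digraph \<Rightarrow> 'a set \<Rightarrow> bool" where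
  "clique G K \<longleftrightarrow> K \<subseteq> verts G \<and> (\<forall>u\<in>K. \<forall>v\<in>K. u \<noteq> v \<longrightarrow> u \<rightarrow>\<^bsub>G\<^esub> v)"

definition independent_set :: "('a, 'b) pre_digraph \<Rightarrow> 'a set \<Rightarrow> bool" where
  "independent_set G I \<longleftrightarrow> I \<subseteq> verts G \<and> (\<forall>u\<in>I. \<forall>v\<in>I. \<not> u \<rightarrow>\<^bsub>G\<^esub> v)"

text \<open>The empty set is a clique, so the clique number of the null graph is 0.\<close>

definition clique_number :: "('a, 'b) pre_digraph \<Rightarrow> nat" where
  "clique_number G = Max {card K | K. clique G K}"

text \<open>
  Because of symmetry the out-degree of a vertex is its degree in the undirected graph (see
  \<open>out_degree_eq_card_neighbours\<close> below). Inserting 0 has an effect only for the null graph,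
  whose maximum degree is 0 by convention.
\<close>

definition max_degree :: "('a, 'b) pre_digraph \<Rightarrow> nat" where
  "max_degree G = Max (insert 0 (out_degree G ` verts G))"

lemma (in nomulti_digraph) out_degree_eq_card_neighbours:
  "out_degree G v = card {u. v \<rightarrow>\<^bsub>G\<^esub> u}"
proof -
  have "bij_betw (head G) (out_arcs G v) {u. v \<rightarrow>\<^bsub>G\<^esub> u}"
    unfolding bij_betw_def inj_on_def
    by (auto simp: arcs_ends_conv arc_to_ends_def image_iff intro: no_multi_arcs)
  then show ?thesis
    unfolding out_degree_def by (rule bij_betw_same_card)
qed

end

theory Submission
  imports Defs
begin

text \<open>
  Write \<open>\<omega>\<close> for the clique number and \<open>\<Delta>\<close> for the maximum degree, so \<open>4 * \<omega> \<ge> 3 * (\<Delta> + 1)\<close>.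
  It suffices to find an independent set that meets every maximum clique.

  Hajnal's inequality says that a nonempty family \<open>Q\<close> of maximum cliques satisfies
  \<open>card (\<Inter> Q) + card (\<Union> Q) \<ge> 2 * \<omega>\<close> (\<open>hajnal_Inter_Union\<close>). If the members of \<open>Q\<close> share a vertex,
  then \<open>\<Union> Q\<close> lies in the closed neighbourhood of that vertex, and so
  \<open>card (\<Inter> Q) \<ge> 2 * \<omega> - (\<Delta> + 1) \<ge> 2 * \<omega> / 3\<close>. Two such intersections inside one maximum clique
  cannot be disjoint. Hence intersecting is an equivalence relation on the maximum cliques
  (\<open>equiv_meeting\<close>), and all cliques in one equivalence class \<open>Q\<close> have a common vertex
  (\<open>Inter_nonempty_if_pairwise_intersecting\<close>).

  A vertex of \<open>\<Inter> Q\<close> is adjacent to everything else in \<open>\<Union> Q\<close>, which has at least \<open>\<omega>\<close> elements; so it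
  has at most \<open>d = \<Delta> + 1 - \<omega>\<close> neighbours outside \<open>\<Union> Q\<close>. The hypothesis is exactly what makes the
  bound \<open>2 * \<omega> - (\<Delta> + 1)\<close> on \<open>card (\<Inter> Q)\<close> at least \<open>2 * d\<close>. Haxell's theorem
  (\<open>haxell_independent_transversal\<close>) therefore yields an independent set with one vertex in each
  \<open>\<Inter> Q\<close>, and this set meets every maximum clique.

  Haxell's theorem rests on \<open>dominating_set_if_no_transversal\<close>: if there is no independent
  transversal, then some \<open>k\<close> parts are dominated by at most \<open>2 * (k - 1)\<close> vertices, which is too
  few when all degrees are at most \<open>d\<close> and all parts have at least \<open>2 * d\<close> elements.
\<close>

section \<open>Independent transversals\<close>

text \<open>
  A choice of one vertex \<open>t i\<close> from each part \<open>V i\<close> such that vertices chosen from different parts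
  are not related by \<open>E\<close>. Parts are indexed by an arbitrary set, values of \<open>t\<close> outside \<open>I\<close> are
  irrelevant, and edges inside a part play no role.
\<close>

definition indep_transversal ::
  "('a \<Rightarrow> 'a \<Rightarrow> bool) \<Rightarrow> 'i set \<Rightarrow> ('i \<Rightarrow> 'a set) \<Rightarrow> ('i \<Rightarrow> 'a) \<Rightarrow> bool" where
  "indep_transversal E I V t \<longleftrightarrow>
    (\<forall>i\<in>I. t i \<in> V i) \<and> (\<forall>i\<in>I. \<forall>j\<in>I. i \<noteq> j \<longrightarrow> \<not> E (t i) (t j))"

lemma indep_transversal_insert:
  assumes "symp E" "indep_transversal E I V t" "a \<notin> I" "w \<in> V a"
    and "\<And>i. i \<in> I \<Longrightarrow> \<not> E w (t i)"
  shows "indep_transversal E (insert a I) V (t(a := w))"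
proof -
  have "\<not> E (t i) w" if "i \<in> I" for i using assms(1,5) that unfolding symp_def by blast
  then show ?thesis using assms(2-5) unfolding indep_transversal_def by auto
qed

text \<open>
  The transversal \<open>t\<close> of all parts but \<open>a\<close> and the vertex \<open>w\<close> of part \<open>a\<close> start an induction on the
  number of parts and then on the number of conflicts of \<open>w\<close> with \<open>t\<close>. If deleting a conflict edge
  \<open>w y\<close> creates no independent transversal, it can be deleted. Otherwise some transversal \<open>s\<close> has
  \<open>w y\<close> as its only edge. Then all vertices dominated by \<open>w\<close> or \<open>y\<close> are removed and the parts of
  \<open>w\<close> and \<open>y\<close> are merged: the new system still has no independent transversal, but \<open>s\<close> is one for
  all parts except the merged one. That the index \<open>a\<close> belongs to \<open>S\<close> is needed for the induction:
  it ensures that splitting the merged part again increases the size of \<open>S\<close>, which pays for the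
  two additional dominating vertices.
\<close>

lemma dominating_set_if_no_transversal:
  fixes E :: "'a \<Rightarrow> 'a \<Rightarrow> bool" and V :: "'i \<Rightarrow> 'a set"
  assumes "finite I" "symp E" "disjoint_family_on V I" "\<nexists>s. indep_transversal E I V s"
    and "a \<in> I" "w \<in> V a" "indep_transversal E (I - {a}) V t"
  shows "\<exists>S Z. S \<subseteq> I \<and> a \<in> S \<and> finite Z \<and> Z \<subseteq> \<Union> (V ` I) \<and> card Z \<le> 2 * (card S - 1)
    \<and> (\<forall>v\<in>\<Union> (V ` S). \<exists>z\<in>Z. E z v)"
  using assms
proof (induction "(card I, card {i \<in> I - {a}. E w (t i)})" arbitrary: I E V w t
    rule: wf_induct_rule[OF wf_lex_prod[OF wf_less_than wf_less_than]])
  case 1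
  note IH = 1(1) and fin = 1(2) and sym = 1(3) and disj = 1(4) and no_it = 1(5)
    and aI = 1(6) and wV = 1(7) and t = 1(8)
  let ?F = "{i \<in> I - {a}. E w (t i)}"
  have tV: "t i \<in> V i" if "i \<in> I" "i \<noteq> a" for i
    using t that unfolding indep_transversal_def by auto
  have "?F \<noteq> {}"
  proof
    assume "?F = {}"
    then have "indep_transversal E (insert a (I - {a})) V (t(a := w))"
      using sym t wV by (intro indep_transversal_insert) auto
    then show False using no_it aI by (simp add: insert_absorb)
  qed
  then obtain c where c: "c \<in> I" "c \<noteq> a" "E w (t c)" by auto
  \<comment> \<open>\<open>E\<close> without the edge between \<open>w\<close> and \<open>t c\<close>\<close>
  define E1 where "E1 u v \<longleftrightarrow> E u v \<and> {u, v} \<noteq> {w, t c}" for u v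
  have uniq: "i = j" if "u \<in> V i" "u \<in> V j" "i \<in> I" "j \<in> I" for u i j
    using disj that unfolding disjoint_family_on_def by blast
  show ?case
  proof (cases "\<exists>s. indep_transversal E1 I V s")
    case False
    have "{i \<in> I - {a}. E1 w (t i)} \<subset> ?F"
      using c unfolding E1_def by auto
    then have "card {i \<in> I - {a}. E1 w (t i)} < card ?F"
      using fin by (intro psubset_card_mono) auto
    moreover have "symp E1"
      using sym unfolding E1_def symp_def by (auto simp: insert_commute)
    moreover have "indep_transversal E1 (I - {a}) V t"
      using t unfolding indep_transversal_def E1_def by blast
    ultimately obtain S Z where "S \<subseteq> I" "a \<in> S" "finite Z" "Z \<subseteq> \<Union> (V ` I)"
      "card Z \<le> 2 * (card S - 1)" "\<forall>v\<in>\<Union> (V ` S). \<exists>z\<in>Z. E1 z v"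
      using IH[of I E1 w t V] fin disj False aI wV by auto
    moreover from this(6) have "\<forall>v\<in>\<Union> (V ` S). \<exists>z\<in>Z. E z v"
      unfolding E1_def by blast
    ultimately show ?thesis by blast
  next
    case True
    then obtain s where s: "indep_transversal E1 I V s" ..
    have sV: "s i \<in> V i" if "i \<in> I" for i
      using s that unfolding indep_transversal_def by auto
    obtain i j where ij: "i \<in> I" "j \<in> I" "i \<noteq> j" "E (s i) (s j)"
      using no_it sV unfolding indep_transversal_def by blast
    then have "{s i, s j} = {w, t c}"
      using s unfolding indep_transversal_def E1_def by blast
    then have "{s i, s j} = {w, t c}" "w \<in> V a" "t c \<in> V c" using wV tV c by auto
    then have sac: "s a = w" "s c = t c"
      using uniq sV ij aI c by (metis doubleton_eq_iff)+
    have s_nonadj: "\<not> E (s i) (s j)" if "i \<in> I" "j \<in> I" "i \<noteq> j" "{i, j} \<noteq> {a, c}" for i j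
    proof
      assume "E (s i) (s j)"
      then have "{s i, s j} = {w, t c}"
        using s that unfolding indep_transversal_def E1_def by blast
      then have "{i, j} = {a, c}"
        using uniq sV that wV tV c aI by (metis doubleton_eq_iff)
      then show False using that by simp
    qed
    let ?y = "t c"
    define N where "N = {v. E w v \<or> E ?y v}"
    \<comment> \<open>the index \<open>a\<close> now stands for the merged part, and the index \<open>c\<close> is dropped\<close>
    define V' where "V' i = (if i = a then V a \<union> V c else V i) - N" for i
    have disj': "disjoint_family_on V' (I - {c})"
      using disj aI c unfolding disjoint_family_on_def V'_def by (auto; blast)
    have no_it': "\<nexists>s. indep_transversal E (I - {c}) V' s"
    proof
      assume "\<exists>s. indep_transversal E (I - {c}) V' s"
      then obtain r where r: "indep_transversal E (I - {c}) V' r" ..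
      have r_V: "r i \<in> V i" if "i \<in> I" "i \<noteq> a" "i \<noteq> c" for i
        using r that unfolding indep_transversal_def V'_def by (auto split: if_splits)
      have r_N: "r i \<notin> N" if "i \<in> I" "i \<noteq> c" for i
        using r that unfolding indep_transversal_def V'_def by auto
      have r_adj: "\<not> E (r i) (r j)" if "i \<in> I" "i \<noteq> c" "j \<in> I" "j \<noteq> c" "i \<noteq> j" for i j
        using r that unfolding indep_transversal_def by auto
      \<comment> \<open>the vertex chosen in the merged part can be completed by \<open>y\<close> or by \<open>w\<close>\<close>
      have "r a \<in> V a \<or> r a \<in> V c"
        using r aI c unfolding indep_transversal_def V'_def by (force split: if_splits)
      then show False
      proof
        assume ra: "r a \<in> V a"
        have "r i \<in> V i" if "i \<in> I - {c}" for i
          using ra r_V that by (cases "i = a") auto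
        then have "indep_transversal E (I - {c}) V r"
          using r_adj unfolding indep_transversal_def by blast
        then have "indep_transversal E (insert c (I - {c})) V (r(c := ?y))"
          using sym r_N tV c by (intro indep_transversal_insert) (auto simp: N_def)
        then show False using no_it c by (simp add: insert_absorb)
      next
        assume ra: "r a \<in> V c"
        have "indep_transversal E (I - {a, c}) V r"
          using r_V r_adj unfolding indep_transversal_def by auto
        then have "indep_transversal E (insert c (I - {a, c})) V (r(c := r a))"
          using sym ra r_adj aI c by (intro indep_transversal_insert) auto
        then have "indep_transversal E (insert a (insert c (I - {a, c}))) V (r(c := r a, a := w))"
        proof (rule indep_transversal_insert[OF sym])
          fix i assume "i \<in> insert c (I - {a, c})"
          then show "\<not> E w ((r(c := r a)) i)" using r_N aI c by (auto simp: N_def)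
        qed (use wV c in auto)
        moreover have "insert a (insert c (I - {a, c})) = I" using aI c by auto
        ultimately show False using no_it by auto
      qed
    qed
    have V'_sub: "\<Union> (V' ` (I - {c})) \<subseteq> \<Union> (V ` I)"
      using aI c unfolding V'_def by (auto split: if_splits)
    have wy_sub: "{w, ?y} \<subseteq> \<Union> (V ` I)" using wV tV aI c by auto
    have card_wy: "card {w, ?y} \<le> 2" by (simp add: card_insert_if)
    show ?thesis
    proof (cases "V' a = {}")
      case True
      have "\<forall>v\<in>\<Union> (V ` {a, c}). \<exists>z\<in>{w, ?y}. E z v"
        using True unfolding V'_def N_def by auto
      moreover have "card {a, c} = 2" using c by auto
      ultimately show ?thesis
        using aI c wy_sub card_wy by (intro exI[of _ "{a, c}"] exI[of _ "{w, ?y}"]) auto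
    next
      case False
      then obtain w' where w': "w' \<in> V' a" by auto
      have "indep_transversal E (I - {c} - {a}) V' s"
        unfolding indep_transversal_def
      proof (intro conjI ballI impI)
        fix i assume i: "i \<in> I - {c} - {a}"
        then have "\<not> E (s a) (s i)" "\<not> E (s c) (s i)"
          using aI c by (intro s_nonadj; auto simp: doubleton_eq_iff)+
        then show "s i \<in> V' i" using sV i sac unfolding V'_def N_def by auto
      qed (use s_nonadj in \<open>auto simp: doubleton_eq_iff\<close>)
      moreover have "card (I - {c}) < card I" using fin c by (intro psubset_card_mono) auto
      ultimately obtain S Z where SZ: "S \<subseteq> I - {c}" "a \<in> S" "finite Z"
          "Z \<subseteq> \<Union> (V' ` (I - {c}))" "card Z \<le> 2 * (card S - 1)" "\<forall>v\<in>\<Union> (V' ` S). \<exists>z\<in>Z. E z v"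
        using IH[of "I - {c}" E w' s V'] fin sym disj' no_it' aI c w' by auto
      have fS: "finite S" using SZ(1) fin by (meson finite_Diff finite_subset)
      have cS: "card (insert c S) = Suc (card S)" using SZ(1) fS by (subst card_insert_disjoint) auto
      have "card S \<noteq> 0" using SZ(2) fS by auto
      then have "card (Z \<union> {w, ?y}) \<le> 2 * (card (insert c S) - 1)"
        using card_Un_le[of Z "{w, ?y}"] card_wy SZ(5) unfolding cS by linarith
      moreover have "\<forall>v\<in>\<Union> (V ` insert c S). \<exists>z\<in>Z \<union> {w, ?y}. E z v"
      proof
        fix v assume v: "v \<in> \<Union> (V ` insert c S)"
        show "\<exists>z\<in>Z \<union> {w, ?y}. E z v"
        proof (cases "v \<in> N")
          case False
          then have "v \<in> \<Union> (V' ` S)" using v SZ(2) unfolding V'_def by auto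
          then show ?thesis using SZ(6) by blast
        qed (auto simp: N_def)
      qed
      moreover have "Z \<union> {w, ?y} \<subseteq> \<Union> (V ` I)" using SZ(4) V'_sub wy_sub by blast
      moreover have "insert c S \<subseteq> I" using SZ(1) c by auto
      ultimately show ?thesis
        using SZ(2,3) by (intro exI[of _ "insert c S"] exI[of _ "Z \<union> {w, ?y}"]) auto
    qed
  qed
qed

text \<open>
  The hypothesis that parts are nonempty matters only for \<open>d = 0\<close>.
\<close>

lemma haxell_independent_transversal:
  fixes E :: "'a \<Rightarrow> 'a \<Rightarrow> bool" and V :: "'i \<Rightarrow> 'a set"
  assumes fin: "finite I" and sym: "symp E" and disj: "disjoint_family_on V I"
    and finV: "\<And>i. i \<in> I \<Longrightarrow> finite (V i)" and ne: "\<And>i. i \<in> I \<Longrightarrow> V i \<noteq> {}"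
    and large: "\<And>i. i \<in> I \<Longrightarrow> 2 * d \<le> card (V i)"
    and deg: "\<And>v. v \<in> \<Union> (V ` I) \<Longrightarrow> finite {u. E v u} \<and> card {u. E v u} \<le> d"
  shows "\<exists>t. indep_transversal E I V t"
  using fin disj finV ne large deg
proof (induction I rule: finite_induct)
  case empty
  then show ?case by (simp add: indep_transversal_def)
next
  case (insert a I)
  have disjI: "disjoint_family_on V I"
    using insert.prems(1) by (rule disjoint_family_on_mono[rotated]) auto
  obtain t where t: "indep_transversal E I V t"
    using insert.IH[OF disjI] insert.prems by auto
  obtain w where w: "w \<in> V a" using insert.prems(3) by blast
  show ?case
  proof (rule ccontr)
    assume "\<nexists>t. indep_transversal E (insert a I) V t"
    then obtain S Z where SZ: "S \<subseteq> insert a I" "a \<in> S" "finite Z" "Z \<subseteq> \<Union> (V ` insert a I)"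
      "card Z \<le> 2 * (card S - 1)" "\<forall>v\<in>\<Union> (V ` S). \<exists>z\<in>Z. E z v"
      using dominating_set_if_no_transversal[of "insert a I" E V a w t]
        insert.hyps insert.prems(1) sym w t by auto
    have fS: "finite S" using SZ(1) insert.hyps(1) finite_subset by blast
    have disjS: "disjoint_family_on V S"
      using SZ(1) insert.prems(1) by (rule disjoint_family_on_mono)
    have "(\<Union> (V ` S)) \<subseteq> (\<Union>z\<in>Z. {u. E z u})" using SZ(6) by blast
    then have "card (\<Union> (V ` S)) \<le> card (\<Union>z\<in>Z. {u. E z u})"
      using SZ(3,4) insert.prems(5) by (intro card_mono finite_UN_I) blast+
    also have "\<dots> \<le> (\<Sum>z\<in>Z. card {u. E z u})" using SZ(3) by (rule card_UN_le)
    also have "\<dots> \<le> card Z * d"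
      using SZ(4) insert.prems(5) by (intro sum_bounded_above[where K = d, simplified]) blast
    also have "\<dots> \<le> (card S - 1) * (2 * d)"
      using mult_right_mono[OF SZ(5), of d] by (simp add: mult.assoc mult.left_commute)
    finally have upper: "card (\<Union> (V ` S)) \<le> (card S - 1) * (2 * d)" .
    have "card (\<Union> (V ` S)) = (\<Sum>i\<in>S. card (V i))"
      using fS SZ(1) insert.prems(2) disjS
      by (intro card_UN_disjoint) (auto simp: disjoint_family_on_def)
    also have "\<dots> = card (V a) + (\<Sum>i\<in>S - {a}. card (V i))"
      using fS SZ(2) by (rule sum.remove)
    also have "\<dots> \<ge> card (V a) + (card S - 1) * (2 * d)"
      using SZ(1,2) fS insert.prems(4)
        sum_bounded_below[of "S - {a}" "2 * d" "\<lambda>i. card (V i)"] by (auto simp: card_Diff_singleton)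
    finally have "card (V a) = 0" using upper by linarith
    then show False using w insert.prems(2) by auto
  qed
qed

section \<open>Intersections and unions of maximum cliques\<close>

text \<open>The cliques of largest size, as vertex sets.\<close>

definition maximum_cliques :: "('a, 'b) pre_digraph \<Rightarrow> 'a set set" where
  "maximum_cliques G = {K. clique G K \<and> card K = clique_number G}"

lemma finite_clique_sizes:
  assumes "finite (verts G)"
  shows "finite {card K | K. clique G K}"
proof -
  have "finite {K. clique G K}"
    using assms by (rule finite_subset[OF _ finite_Pow_iff[THEN iffD2], rotated]) (auto simp: clique_def)
  then show ?thesis by (simp add: setcompr_eq_image)
qed

lemma clique_number_attained:
  assumes "finite (verts G)"
  shows "\<exists>K. clique G K \<and> card K = clique_number G"
proof -
  have "clique G {}" by (simp add: clique_def)
  then have "Max {card K | K. clique G K} \<in> {card K | K. clique G K}"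
    using finite_clique_sizes[OF assms] by (intro Max_in) auto
  then show ?thesis unfolding clique_number_def by auto
qed

context graph
begin

lemma clique_subset_verts: "clique G K \<Longrightarrow> K \<subseteq> verts G"
  by (simp add: clique_def)

lemma finite_clique: "clique G K \<Longrightarrow> finite K"
  by (rule finite_subset[OF clique_subset_verts finite_verts])

lemma card_clique_le: "clique G K \<Longrightarrow> card K \<le> clique_number G"
  unfolding clique_number_def using finite_clique_sizes[OF finite_verts] by (intro Max_ge) auto

lemma finite_maximum_cliques: "finite (maximum_cliques G)"
  by (rule finite_subset[of _ "Pow (verts G)"]) (auto simp: maximum_cliques_def clique_def)

lemma finite_neighbours: "finite {u. v \<rightarrow>\<^bsub>G\<^esub> u}"
  by (rule finite_subset[of _ "verts G"]) auto

lemma card_neighbours_le: "v \<in> verts G \<Longrightarrow> card {u. v \<rightarrow>\<^bsub>G\<^esub> u} \<le> max_degree G"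
  unfolding max_degree_def by (subst out_degree_eq_card_neighbours[symmetric], intro Max_ge) auto

lemma adj_of_Inter_Union:
  assumes "Q \<subseteq> maximum_cliques G" "v \<in> \<Inter> Q" "u \<in> \<Union> Q" "u \<noteq> v"
  shows "v \<rightarrow>\<^bsub>G\<^esub> u"
proof -
  obtain K where K: "K \<in> Q" "u \<in> K" using assms(3) by blast
  then have "clique G K" "v \<in> K" using assms(1,2) by (auto simp: maximum_cliques_def)
  then show ?thesis using K(2) assms(4) by (simp add: clique_def)
qed

lemma Union_maximum_cliques_subset_verts:
  "Q \<subseteq> maximum_cliques G \<Longrightarrow> \<Union> Q \<subseteq> verts G"
  using clique_subset_verts unfolding maximum_cliques_def by blast

lemma finite_Union_maximum_cliques:
  "Q \<subseteq> maximum_cliques G \<Longrightarrow> finite (\<Union> Q)"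
  by (rule finite_subset[OF Union_maximum_cliques_subset_verts finite_verts])

text \<open>
  Hajnal's inequality. When a clique \<open>A\<close> is added to \<open>Q\<close>, the set \<open>\<Inter> Q \<union> (A \<inter> \<Union> Q)\<close> is again a clique,
  so it has at most \<open>\<omega>\<close> elements; this says that the intersection shrinks by no more than the union
  grows.
\<close>

lemma hajnal_Inter_Union:
  assumes "Q \<subseteq> maximum_cliques G" "Q \<noteq> {}"
  shows "2 * clique_number G \<le> card (\<Inter> Q) + card (\<Union> Q)"
proof -
  have "finite Q" using assms finite_maximum_cliques finite_subset by blast
  then show ?thesis using assms(2,1)
  proof (induction Q rule: finite_ne_induct)
    case (singleton A)
    then show ?case by (simp add: maximum_cliques_def)
  next
    case (insert A Q)
    let ?C = "\<Inter> Q" and ?U = "\<Union> Q"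
    have A: "clique G A" "card A = clique_number G" and Q: "Q \<subseteq> maximum_cliques G"
      using insert.prems by (auto simp: maximum_cliques_def)
    have CU: "?C \<subseteq> ?U" using insert.hyps(2) by auto
    have fU: "finite ?U" using Q by (rule finite_Union_maximum_cliques)
    have fC: "finite ?C" using CU fU finite_subset by blast
    have fA: "finite A" using A(1) by (rule finite_clique)
    have "clique G (?C \<union> (A \<inter> ?U))"
      unfolding clique_def
    proof (intro conjI ballI impI)
      show "?C \<union> (A \<inter> ?U) \<subseteq> verts G" 
        using clique_subset_verts[OF A(1)] CU Union_maximum_cliques_subset_verts[OF Q] by blast
      fix u v assume uv: "u \<in> ?C \<union> (A \<inter> ?U)" "v \<in> ?C \<union> (A \<inter> ?U)" "u \<noteq> v"
      show "u \<rightarrow>\<^bsub>G\<^esub> v"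
      proof (cases "u \<in> ?C \<or> v \<in> ?C")
        case True
        then show ?thesis
          using adj_of_Inter_Union[OF Q, of u v] adj_of_Inter_Union[OF Q, of v u] uv CU
          by (metis IntE UnE arcs_ends_symmetric sym_arcs subsetD)
      next
        case False
        then show ?thesis using uv A(1) by (auto simp: clique_def)
      qed
    qed
    then have "card (?C \<union> (A \<inter> ?U)) \<le> clique_number G" by (rule card_clique_le)
    moreover have "card ?C + card (A \<inter> ?U) = card (?C \<union> (A \<inter> ?U)) + card (?C \<inter> (A \<inter> ?U))"
      using fC fA by (intro card_Un_Int) auto
    moreover have "card (?C \<inter> (A \<inter> ?U)) = card (\<Inter> (insert A Q))"
      using CU by (intro arg_cong[where f = card]) auto
    moreover have "card A + card ?U = card (\<Union> (insert A Q)) + card (A \<inter> ?U)"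
      using card_Un_Int[OF fA fU] by simp
    ultimately show ?case using insert.IH[OF Q] A(2) by linarith
  qed
qed

lemma card_Union_le_if_common_vertex:
  assumes "Q \<subseteq> maximum_cliques G" "Q \<noteq> {}" "v \<in> \<Inter> Q"
  shows "card (\<Union> Q) + card ({u. v \<rightarrow>\<^bsub>G\<^esub> u} - \<Union> Q) \<le> max_degree G + 1"
proof -
  have fU: "finite (\<Union> Q)" using assms(1) by (rule finite_Union_maximum_cliques)
  have "v \<in> \<Union> Q" using assms(2,3) by blast
  then have v: "v \<in> verts G" "v \<in> \<Union> Q"
    using Union_maximum_cliques_subset_verts[OF assms(1)] by auto
  have "\<Union> Q \<union> ({u. v \<rightarrow>\<^bsub>G\<^esub> u} - \<Union> Q) \<subseteq> insert v {u. v \<rightarrow>\<^bsub>G\<^esub> u}"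
    using adj_of_Inter_Union[OF assms(1,3)] by auto
  then have "card (\<Union> Q \<union> ({u. v \<rightarrow>\<^bsub>G\<^esub> u} - \<Union> Q)) \<le> card (insert v {u. v \<rightarrow>\<^bsub>G\<^esub> u})"
    using finite_neighbours by (intro card_mono) auto
  also have "\<dots> \<le> max_degree G + 1"
    using card_neighbours_le[OF v(1)] finite_neighbours[of v]
    by (simp add: card_insert_if)
  finally show ?thesis
    using fU finite_neighbours[of v] by (subst (asm) card_Un_disjoint) auto
qed

lemma card_Inter_ge_if_common_vertex:
  assumes "Q \<subseteq> maximum_cliques G" "Q \<noteq> {}" "\<Inter> Q \<noteq> {}"
  shows "2 * clique_number G \<le> card (\<Inter> Q) + (max_degree G + 1)"
proof -
  obtain v where "v \<in> \<Inter> Q" using assms(3) by blast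
  then show ?thesis
    using hajnal_Inter_Union[OF assms(1,2)] card_Union_le_if_common_vertex[OF assms(1,2)]
    by (meson add_leD1 add_left_mono le_trans)
qed

text \<open>
  Both \<open>A \<inter> B\<close> and \<open>\<Inter> Q\<close> are subsets of \<open>B\<close> with more than half as many elements.
\<close>

lemma Inter_insert_nonempty:
  assumes "3 * (max_degree G + 1) \<le> 4 * clique_number G"
    and "insert A Q \<subseteq> maximum_cliques G" "B \<in> Q" "A \<inter> B \<noteq> {}" "\<Inter> Q \<noteq> {}"
  shows "A \<inter> \<Inter> Q \<noteq> {}"
proof
  assume empty: "A \<inter> \<Inter> Q = {}"
  have B: "clique G B" "card B = clique_number G"
    using assms(2,3) by (auto simp: maximum_cliques_def)
  have fB: "finite B" using B(1) by (rule finite_clique)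
  have "2 * clique_number G \<le> card (\<Inter> {A, B}) + (max_degree G + 1)"
    using assms by (intro card_Inter_ge_if_common_vertex) auto
  moreover have "2 * clique_number G \<le> card (\<Inter> Q) + (max_degree G + 1)"
    using assms by (intro card_Inter_ge_if_common_vertex) auto
  moreover have "card ((A \<inter> B) \<union> \<Inter> Q) \<le> clique_number G"
    unfolding B(2)[symmetric] using fB assms(3) by (intro card_mono) auto
  moreover have "card ((A \<inter> B) \<union> \<Inter> Q) = card (A \<inter> B) + card (\<Inter> Q)"
    using empty fB assms(3) by (intro card_Un_disjoint) (auto intro: finite_subset[of _ B])
  ultimately show False using assms(1) by simp
qed

lemma Inter_nonempty_if_pairwise_intersecting:
  assumes "3 * (max_degree G + 1) \<le> 4 * clique_number G"
    and "Q \<subseteq> maximum_cliques G" "Q \<noteq> {}" "\<And>A B. A \<in> Q \<Longrightarrow> B \<in> Q \<Longrightarrow> A \<inter> B \<noteq> {}"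
  shows "\<Inter> Q \<noteq> {}"
proof -
  have "finite Q" using assms finite_maximum_cliques finite_subset by blast
  then show ?thesis using assms(3,2,4)
  proof (induction Q rule: finite_ne_induct)
    case (singleton A)
    then show ?case by auto
  next
    case (insert A Q)
    obtain B where B: "B \<in> Q" using insert.hyps(2) by blast
    have "\<Inter> Q \<noteq> {}" using insert.IH insert.prems by simp
    moreover have "A \<inter> B \<noteq> {}" using insert.prems(2) B by simp
    ultimately show ?case
      using Inter_insert_nonempty[OF assms(1) insert.prems(1) B] by simp
  qed
qed

section \<open>An independent set meeting all maximum cliques\<close>

text \<open>The relation of having a common vertex, on maximum cliques.\<close>

definition meeting :: "('a set \<times> 'a set) set" where
  "meeting = {(A, B). A \<in> maximum_cliques G \<and> B \<in> maximum_cliques G \<and> A \<inter> B \<noteq> {}}"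

lemma equiv_meeting:
  assumes "3 * (max_degree G + 1) \<le> 4 * clique_number G"
  shows "equiv (maximum_cliques G) meeting"
proof (rule equivI)
  show "meeting \<subseteq> maximum_cliques G \<times> maximum_cliques G" by (auto simp: meeting_def)
  show "refl_on (maximum_cliques G) meeting"
  proof (rule refl_onI)
    fix K assume K: "K \<in> maximum_cliques G"
    then have "card K \<noteq> 0" using assms by (simp add: maximum_cliques_def)
    then show "(K, K) \<in> meeting" using K by (auto simp: meeting_def)
  qed
  show "sym meeting" by (auto simp: meeting_def sym_def)
  show "trans meeting"
  proof (rule transI)
    fix A B C assume "(A, B) \<in> meeting" "(B, C) \<in> meeting"
    then have AC: "A \<in> maximum_cliques G" "C \<in> maximum_cliques G"
      and "B \<in> maximum_cliques G" "A \<inter> B \<noteq> {}" "B \<inter> C \<noteq> {}"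
      by (auto simp: meeting_def)
    then have "A \<inter> \<Inter> {B, C} \<noteq> {}" by (intro Inter_insert_nonempty[OF assms]) auto
    then show "(A, C) \<in> meeting" using AC by (auto simp: meeting_def)
  qed
qed

lemma independent_set_hitting_maximum_cliques:
  assumes large: "3 * (max_degree G + 1) \<le> 4 * clique_number G"
  shows "\<exists>I. independent_set G I \<and> (\<forall>K\<in>maximum_cliques G. K \<inter> I \<noteq> {})"
proof -
  let ?\<omega> = "clique_number G" and ?M = "maximum_cliques G"
  define P where "P = ?M // meeting"
  define d where "d = max_degree G + 1 - ?\<omega>"
  \<comment> \<open>Edges inside the union of a class are discarded: a vertex of \<open>\<Inter> Q\<close> may have many neighbours in
    \<open>\<Union> Q\<close>, but those lie in no \<open>\<Inter> R\<close> for another class \<open>R\<close>.\<close>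
  define E where "E u v \<longleftrightarrow> u \<rightarrow>\<^bsub>G\<^esub> v \<and> (\<forall>Q\<in>P. \<not> (u \<in> \<Union> Q \<and> v \<in> \<Union> Q))" for u v
  have eq: "equiv ?M meeting" using large by (rule equiv_meeting)
  have finP: "finite P"
    unfolding P_def using finite_maximum_cliques
    by (rule finite_quotient) (auto simp: meeting_def)
  have P_sub: "Q \<subseteq> ?M" and P_ne: "Q \<noteq> {}" if "Q \<in> P" for Q
    using that eq in_quotient_imp_subset in_quotient_imp_non_empty unfolding P_def by blast+
  have P_meet: "A \<inter> B \<noteq> {}" if "Q \<in> P" "A \<in> Q" "B \<in> Q" for Q A B
    using in_quotient_imp_in_rel[OF eq, of Q A B] that unfolding P_def meeting_def by auto
  have P_eq: "Q = R" if "Q \<in> P" "R \<in> P" "v \<in> \<Union> Q" "v \<in> \<Union> R" for Q R v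
  proof -
    obtain A B where AB: "A \<in> Q" "B \<in> R" "v \<in> A" "v \<in> B" using \<open>v \<in> \<Union> Q\<close> \<open>v \<in> \<Union> R\<close> by blast
    then have "(A, B) \<in> meeting" using that P_sub unfolding meeting_def by blast
    then show ?thesis using quotient_eq_iff[OF eq] that AB unfolding P_def by blast
  qed
  have Inter_ne: "\<Inter> Q \<noteq> {}" if "Q \<in> P" for Q
    
    using large P_sub[OF that] P_ne[OF that] P_meet[OF that]
    by (rule Inter_nonempty_if_pairwise_intersecting)
  have Inter_sub: "\<Inter> Q \<subseteq> \<Union> Q" if "Q \<in> P" for Q using P_ne[OF that] by auto
  have "\<exists>t. indep_transversal E P Inter t"
  proof (rule haxell_independent_transversal[where d = d])
    show "finite P" by (rule finP)
    show "symp E" using arcs_ends_symmetric[OF sym_arcs] by (auto simp: E_def symp_def)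
    show "disjoint_family_on Inter P"
      unfolding disjoint_family_on_def
    proof (intro ballI impI)
      fix Q R assume "Q \<in> P" "R \<in> P" "Q \<noteq> R"
      then show "\<Inter> Q \<inter> \<Inter> R = {}" using P_eq[of Q R] Inter_sub[of Q] Inter_sub[of R] by blast
    qed
    fix Q assume Q: "Q \<in> P"
    show "finite (\<Inter> Q)"
      by (rule finite_subset[OF Inter_sub[OF Q] finite_Union_maximum_cliques[OF P_sub[OF Q]]])
    show "\<Inter> Q \<noteq> {}" using Q by (rule Inter_ne)
    show "2 * d \<le> card (\<Inter> Q)"
      using card_Inter_ge_if_common_vertex[OF P_sub[OF Q] P_ne[OF Q] Inter_ne[OF Q]] large
      unfolding d_def by arith
  next
    fix v assume "v \<in> \<Union> (Inter ` P)"
    then obtain Q where Q: "Q \<in> P" "v \<in> \<Inter> Q" by blast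
    have sub: "{u. E v u} \<subseteq> {u. v \<rightarrow>\<^bsub>G\<^esub> u} - \<Union> Q"
    proof
      fix u assume "u \<in> {u. E v u}"
      then show "u \<in> {u. v \<rightarrow>\<^bsub>G\<^esub> u} - \<Union> Q"
        using Q(1) subsetD[OF Inter_sub[OF Q(1)] Q(2)] unfolding E_def by blast
    qed
    have fin: "finite ({u. v \<rightarrow>\<^bsub>G\<^esub> u} - \<Union> Q)" using finite_neighbours by (rule finite_Diff)
    obtain K where K: "K \<in> Q" using P_ne[OF Q(1)] by blast
    then have "K \<in> ?M" using P_sub[OF Q(1)] by (rule subsetD[rotated])
    then have "card K = ?\<omega>" by (simp add: maximum_cliques_def)
    moreover have "card K \<le> card (\<Union> Q)"
      using K finite_Union_maximum_cliques[OF P_sub[OF Q(1)]] by (intro card_mono) auto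
    moreover have "card {u. E v u} \<le> card ({u. v \<rightarrow>\<^bsub>G\<^esub> u} - \<Union> Q)" using fin sub by (rule card_mono)
    ultimately have "card {u. E v u} \<le> d"
      using card_Union_le_if_common_vertex[OF P_sub[OF Q(1)] P_ne[OF Q(1)] Q(2)]
      unfolding d_def by arith
    then show "finite {u. E v u} \<and> card {u. E v u} \<le> d" using finite_subset[OF sub fin] by blast
  qed
  then obtain t where t: "indep_transversal E P Inter t" ..
  have tQ: "t Q \<in> \<Inter> Q" if "Q \<in> P" for Q using t that unfolding indep_transversal_def by blast
  have tU: "t Q \<in> \<Union> Q" if "Q \<in> P" for Q using tQ[OF that] Inter_sub[OF that] by blast
  have "\<not> t Q \<rightarrow>\<^bsub>G\<^esub> t R" if QR: "Q \<in> P" "R \<in> P" for Q R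
  proof
    assume adj: "t Q \<rightarrow>\<^bsub>G\<^esub> t R"
    then have "Q \<noteq> R" using adj_not_same[of "t R"] by metis
    then have "\<not> E (t Q) (t R)" using t QR unfolding indep_transversal_def by blast
    then obtain S where "S \<in> P" "t Q \<in> \<Union> S" "t R \<in> \<Union> S" using adj unfolding E_def by blast
    then have "S = Q" "S = R" using P_eq[of S] tU QR by auto
    then show False using \<open>Q \<noteq> R\<close> by simp
  qed
  moreover have "t Q \<in> verts G" if "Q \<in> P" for Q
    using tU[OF that] Union_maximum_cliques_subset_verts[OF P_sub[OF that]] by blast
  ultimately have "independent_set G (t ` P)" unfolding independent_set_def by auto
  moreover have "K \<inter> t ` P \<noteq> {}" if K: "K \<in> ?M" for K
  proof -
    obtain Q where "Q \<in> P" "K \<in> Q" using K Union_quotient[OF eq] unfolding P_def by blast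
    then show ?thesis using tQ by blast
  qed
  ultimately show ?thesis by blast
qed

end

theorem mainTheorem1:
  fixes G :: "('a, 'b) pre_digraph"
  assumes "graph G"
    and "real (clique_number G) \<ge> 3 / 4 * (real (max_degree G) + 1)"
  shows "\<exists>I. independent_set G I \<and> clique_number (G \<restriction> (verts G - I)) < clique_number G"
proof -
  interpret graph G by fact
  have "3 * (max_degree G + 1) \<le> 4 * clique_number G" using assms(2)
    by (simp flip: of_nat_le_iff[where 'a = real])
  then obtain I where I: "independent_set G I" "\<forall>K\<in>maximum_cliques G. K \<inter> I \<noteq> {}"
    using independent_set_hitting_maximum_cliques by blast
  let ?H = "G \<restriction> (verts G - I)"
  obtain K where K: "clique ?H K" "card K = clique_number ?H" 
    using clique_number_attained[of ?H] by auto
  have "arcs_ends ?H \<subseteq> arcs_ends G" by (auto simp: arcs_ends_conv)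
  then have "clique G K" using K(1) unfolding clique_def by auto
  moreover have "K \<inter> I = {}" using K(1) unfolding clique_def by auto
  ultimately have "card K \<le> clique_number G" "card K \<noteq> clique_number G"
    using I(2) card_clique_le unfolding maximum_cliques_def by auto
  then show ?thesis using I(1) K(2) by auto
qed

end
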